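(* Let $\{k_n\}_{n=0}^\infty$ be a building sequence of the family of random multi-hooking networks $\{G_n\}_{n\ge 1}$, starting from a seed $G_0$ with $\tau_0\ge 2$ vertices and total path length $T_0$. Let $T_n$ be the total path length of $G_n$, after $n$ steps of evolution according to the building sequence. Then $$\mathbb{E}[T_n]=T_0\,\tau_n\Big(\sum_{i=1}^n\frac{k_{i-1}}{\tau_i}+\frac1{\tau_0}\Big).$$
   Context: Seed. $G_0$ is a connected finite graph (loops and multiple edges are allowed) with $\tau_0\ge 2$ vertices, one of which is designated as the hook $h$. Building sequence. A sequence of integers $\{k_n\}_{n=0}^\infty$ with $k_n\ge 1$ is a building sequence (for a seed of order $\tau_0$) if: (i) $k_n\le \tau_0+(\tau_0-1)\sum_{i=0}^{n-1}k_i$ for all $n\ge 0$; (ii) the limit $a:=\lim_{n\to\infty} k_n/\sum_{i=0}^n k_i$ exists in $[0,1]$; (iii) the limit $b:=\lim_{n\to\infty}\tau_0/k_n\ge 0$ exists. Random multi-hooking network. For $n\ge 1$, given $G_{n-1}=(V_{n-1},\mathcal{E}_{n-1})$, a set of $k_{n-1}$ distinct vertices of $G_{n-1}$, called latches, is chosen uniformly at random among all subsets of $V_{n-1}$ of size $k_{n-1}$ (given the whole past). For each latch a fresh copy of the seed is taken and its hook is fused (identified) with the latch; distinct latches receive distinct copies. The result is $G_n$. The order of $G_n$ is deterministic: $\tau_n=|V_n|=\tau_0+(\tau_0-1)\sum_{i=1}^n k_{i-1}$. Total path length. The reference vertex of $G_n$ is the hook of the initial seed $G_0$ (viewed as a vertex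 of $G_n$). The depth of a vertex of $G_n$ is its graph distance in $G_n$ (number of edges on a shortest path) to the reference vertex. $T_n$ is the sum of the depths of all vertices of $G_n$. *)

theory Defs
  imports "HOL-Probability.Probability" "HOL-Library.Uprod" "HOL-Library.Multiset"
begin

text \<open>
  Undirected multigraphs. An edge is an unordered pair of end vertices, a loop at \<open>u\<close> being
  \<open>Upair u u\<close>; parallel edges are accounted for by the multiplicity in the edge multiset.
\<close>

datatype 'a multigraph =
  Multigraph (vertices: "'a set") (edges: "'a uprod multiset")

definition finite_multigraph :: "'a multigraph \<Rightarrow> bool" where
  "finite_multigraph G \<longleftrightarrow>
     finite (vertices G) \<and> (\<forall>e \<in># edges G. set_uprod e \<subseteq> vertices G)"

definition adjacent :: "'a multigraph \<Rightarrow> 'a \<Rightarrow> 'a \<Rightarrow> bool" where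
  "adjacent G u v \<longleftrightarrow> Upair u v \<in># edges G"

text \<open>A path is given by its list of vertices, so it has \<open>length p - 1\<close> edges.\<close>

definition is_path :: "'a multigraph \<Rightarrow> 'a \<Rightarrow> 'a list \<Rightarrow> 'a \<Rightarrow> bool" where
  "is_path G u p v \<longleftrightarrow>
     p \<noteq> [] \<and> hd p = u \<and> last p = v \<and> set p \<subseteq> vertices G \<and>
     distinct p \<and> successively (adjacent G) p"

definition connected_multigraph :: "'a multigraph \<Rightarrow> bool" where
  "connected_multigraph G \<longleftrightarrow>
     vertices G \<noteq> {} \<and> (\<forall>u \<in> vertices G. \<forall>v \<in> vertices G. \<exists>p. is_path G u p v)"

definition graph_distance :: "'a multigraph \<Rightarrow> 'a \<Rightarrow> 'a \<Rightarrow> nat" where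
  "graph_distance G u v = (LEAST d. \<exists>p. is_path G u p v \<and> length p - 1 = d)"

definition total_path_length :: "'a multigraph \<Rightarrow> 'a \<Rightarrow> nat" where
  "total_path_length G r = (\<Sum>v \<in> vertices G. graph_distance G r v)"

definition rename :: "('a \<Rightarrow> 'b) \<Rightarrow> 'a multigraph \<Rightarrow> 'b multigraph" where
  "rename f G = Multigraph (f ` vertices G) (image_mset (map_uprod f) (edges G))"

definition building_sequence :: "nat \<Rightarrow> (nat \<Rightarrow> nat) \<Rightarrow> bool" where
  "building_sequence t0 k \<longleftrightarrow>
     (\<forall>n. 1 \<le> k n) \<and>
     (\<forall>n. k n \<le> t0 + (t0 - 1) * (\<Sum>i<n. k i)) \<and>
     (\<exists>a::real. 0 \<le> a \<and> a \<le> 1 \<and> (\<lambda>n. real (k n) / real (\<Sum>i\<le>n. k i)) \<longlonglongrightarrow> a) \<and>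
     (\<exists>b::real. 0 \<le> b \<and> (\<lambda>n. real t0 / real (k n)) \<longlonglongrightarrow> b)"

text \<open>
  Vertices of the networks. \<open>Orig u\<close> is the vertex \<open>u\<close> of the initial seed, and
  \<open>Copy n v u\<close> is the vertex \<open>u\<close>, other than the hook, of the copy of the seed
  whose hook is fused with the latch \<open>v\<close> in step \<open>n\<close>. The tags make distinct copies
  disjoint from each other and from the existing network, apart from the fused vertices.
\<close>

datatype 'a vertex = Orig 'a | Copy nat "'a vertex" 'a

definition fuse :: "'a \<Rightarrow> nat \<Rightarrow> 'a vertex \<Rightarrow> 'a \<Rightarrow> 'a vertex" where
  "fuse h n v u = (if u = h then v else Copy n v u)"

definition hook_at ::
    "'a multigraph \<Rightarrow> 'a \<Rightarrow> nat \<Rightarrow> 'a vertex multigraph \<Rightarrow> 'a vertex set \<Rightarrow> 'a vertex multigraph" where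
  "hook_at S h n G L =
     Multigraph
       (vertices G \<union> (\<Union>v\<in>L. vertices (rename (fuse h n v) S)))
       (edges G + (\<Sum>v\<in>L. edges (rename (fuse h n v) S)))"

text \<open>
  The law of \<open>G\<^sub>n\<close>. By the tags, if the seed has at least two vertices, \<open>G\<^sub>n\<close> determines all earlier latch sets, so that
  conditioning on \<open>G\<^sub>n\<close> is the same as conditioning on the whole past.
\<close>

primrec network :: "'a multigraph \<Rightarrow> 'a \<Rightarrow> (nat \<Rightarrow> nat) \<Rightarrow> nat \<Rightarrow> 'a vertex multigraph pmf" where
  "network S h k 0 = return_pmf (rename Orig S)"
| "network S h k (Suc n) =
     bind_pmf (network S h k n) (\<lambda>G.
       map_pmf (hook_at S h (Suc n) G)
         (pmf_of_set {L. L \<subseteq> vertices G \<and> card L = k n}))"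

definition network_order :: "nat \<Rightarrow> (nat \<Rightarrow> nat) \<Rightarrow> nat \<Rightarrow> nat" where
  "network_order t0 k n = t0 + (t0 - 1) * (\<Sum>i=1..n. k (i - 1))"

text \<open>Every realisation of \<open>G\<^sub>n\<close> has \<open>network_order\<close> many vertices.\<close>

fun stage :: "'a vertex \<Rightarrow> nat" where
  "stage (Orig u) = 0"
| "stage (Copy n v u) = n"

lemma network_order_Suc: "network_order t0 k (Suc n) = network_order t0 k n + (t0 - 1) * k n"
  by (simp add: network_order_def algebra_simps)

lemma card_vertices_hook_at:
  assumes S: "finite (vertices S)" "h \<in> vertices S"
    and G: "finite (vertices G)" "\<forall>x \<in> vertices G. stage x < n"
    and L: "L \<subseteq> vertices G"
  shows "card (vertices (hook_at S h n G L)) = card (vertices G) + (card (vertices S) - 1) * card L"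
proof -
  let ?N = "(\<lambda>(v, u). Copy n v u) ` (L \<times> (vertices S - {h}))"
  have eq: "vertices (hook_at S h n G L) = vertices G \<union> ?N"
    using L S(2) by (auto simp: hook_at_def rename_def fuse_def image_iff)
  have "finite L"
    using L G(1) finite_subset by blast
  moreover have "vertices G \<inter> ?N = {}"
    using G(2) by fastforce
  moreover have "card ?N = card L * (card (vertices S) - 1)"
    using S by (subst card_image) (auto simp: inj_on_def card_cartesian_product)
  ultimately show ?thesis
    using S(1) G(1) by (simp add: eq card_Un_disjoint mult.commute)
qed

lemma network_vertices:
  assumes S: "finite (vertices S)" "h \<in> vertices S"
    and k: "building_sequence (card (vertices S)) k"
    and G: "G \<in> set_pmf (network S h k n)"
  shows "finite (vertices G) \<and> (\<forall>x \<in> vertices G. stage x \<le> n) \<and>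
         card (vertices G) = network_order (card (vertices S)) k n"
  using G
proof (induction n arbitrary: G)
  case 0
  then show ?case
    using S by (auto simp: rename_def network_order_def card_image inj_on_def)
next
  case (Suc n)
  then obtain H where H: "H \<in> set_pmf (network S h k n)"
    and G: "G \<in> hook_at S h (Suc n) H ` set_pmf (pmf_of_set {L. L \<subseteq> vertices H \<and> card L = k n})"
    by auto
  note IH = Suc.IH[OF H]
  have "k n \<le> card (vertices H)"
    using k IH unfolding building_sequence_def network_order_def
    by (simp add: sum.atLeast1_atMost_eq lessThan_atLeast0)
  then have "{L. L \<subseteq> vertices H \<and> card L = k n} \<noteq> {}"
    by (metis (mono_tags, lifting) empty_Collect_eq obtain_subset_with_card_n)
  then obtain L where L: "L \<subseteq> vertices H" "card L = k n" and G: "G = hook_at S h (Suc n) H L"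
    using G IH by (auto simp: set_pmf_of_set)
  have fL: "finite L"
    using L(1) IH finite_subset by blast
  have lt: "\<forall>x \<in> vertices H. stage x < Suc n"
    using IH by auto
  have "finite (vertices G)"
    using IH S fL by (simp add: G hook_at_def rename_def)
  moreover have "\<forall>x \<in> vertices G. stage x \<le> Suc n"
    using lt L by (auto simp: G hook_at_def rename_def fuse_def less_imp_le)
  ultimately show ?case
    using card_vertices_hook_at[OF S _ lt L(1)] IH L(2) by (simp add: G network_order_Suc)
qed

end

theory Submission imports Defs begin

text \<open>
  A vertex \<open>u\<close> of the copy of the seed hooked at the latch \<open>v\<close> has depth \<open>d v + d\<^sub>0 u\<close>, where \<open>d\<close> is the
  depth in the old network and \<open>d\<^sub>0\<close> the depth in the seed, while old vertices keep their depth. Hence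
  \<open>T\<^sub>n\<^sub>+\<^sub>1 = T\<^sub>n + (\<tau>\<^sub>0 - 1) (\<Sum>v\<in>L. d v) + k\<^sub>n T\<^sub>0\<close>. Each vertex is a latch with probability \<open>k\<^sub>n / \<tau>\<^sub>n\<close>,
  so \<open>E T\<^sub>n\<^sub>+\<^sub>1 = (\<tau>\<^sub>n\<^sub>+\<^sub>1 / \<tau>\<^sub>n) E T\<^sub>n + k\<^sub>n T\<^sub>0\<close>, which telescopes after division by \<open>\<tau>\<^sub>n\<^sub>+\<^sub>1\<close>.
\<close>

section \<open>Distances from a fixed vertex through local labellings\<close>

text \<open>
  These local conditions determine the distance from \<open>r\<close>, so that distances in a network can be
  computed by extending a labelling instead of manipulating paths.
\<close>

definition distance_labelling :: "'a multigraph \<Rightarrow> 'a \<Rightarrow> ('a \<Rightarrow> nat) \<Rightarrow> bool" where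
  "distance_labelling G r f \<longleftrightarrow>
     r \<in> vertices G \<and> f r = 0 \<and>
     (\<forall>u v. adjacent G u v \<longrightarrow> u \<in> vertices G \<and> v \<in> vertices G \<and> f v \<le> Suc (f u)) \<and>
     (\<forall>v \<in> vertices G. v \<noteq> r \<longrightarrow> (\<exists>u. adjacent G u v \<and> f v = Suc (f u)))"

lemma graph_distance_le:
  assumes "is_path G u p v"
  shows "graph_distance G u v \<le> length p - 1"
  unfolding graph_distance_def using assms by (blast intro: Least_le)

lemma shortest_path_exists:
  assumes "is_path G u p v"
  obtains q where "is_path G u q v" "length q = Suc (graph_distance G u v)"
proof -
  have "\<exists>q. is_path G u q v \<and> length q - 1 = graph_distance G u v"
    unfolding graph_distance_def using assms by (rule_tac LeastI_ex) blast
  then obtain q where "is_path G u q v" "length q - 1 = graph_distance G u v"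
    by blast
  \<comment> \<open>\<open>length q - 1\<close> is truncated subtraction, so the exact length is
    recovered only for a nonempty list.\<close>
  moreover from this have "q \<noteq> []"
    by (simp add: is_path_def)
  ultimately show thesis
    using that by (cases q) auto
qed

text \<open>Along each edge the label rises by at most one, and it starts at 0. The induction runs
  over walks with an arbitrary first vertex, since the tail of a path no longer starts at
  \<open>r\<close>.\<close>

lemma labelling_le_path_length:
  assumes f: "distance_labelling G r f" and p: "is_path G r p v"
  shows "f v \<le> length p - 1"
proof -
  have "f (last p) \<le> f (hd p) + (length p - 1)"
    if "successively (adjacent G) p" "p \<noteq> []" for p
    using that
  proof (induction p rule: induct_list012)
    case (3 x y zs)
    then have "f y \<le> Suc (f x)"
      using f by (auto simp: distance_labelling_def)
    with 3 show ?case
      by auto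
  qed auto
  from this[of p] p f show ?thesis
    by (auto simp: is_path_def distance_labelling_def)
qed

text \<open>Stepping repeatedly to a neighbour whose label is one smaller ends at \<open>r\<close>.
  The bound on the labels along the path strengthens the induction: it shows that \<open>v\<close>
  is not yet on the path to its predecessor, so that appending \<open>v\<close> keeps the path
  \<open>distinct\<close>.\<close>

lemma labelling_path_exists:
  assumes f: "distance_labelling G r f" and v: "v \<in> vertices G"
  shows "\<exists>p. is_path G r p v \<and> length p = Suc (f v) \<and> (\<forall>x \<in> set p. f x \<le> f v)"
  using v
proof (induction "f v" arbitrary: v rule: less_induct)
  case less
  show ?case
  proof (cases "v = r")
    case True
    then show ?thesis
      using f by (intro exI[of _ "[r]"]) (auto simp: is_path_def distance_labelling_def)
  next
    case False
    then obtain u where u: "adjacent G u v" "f v = Suc (f u)"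
      using f less.prems unfolding distance_labelling_def by blast
    then have "u \<in> vertices G"
      using f by (auto simp: distance_labelling_def)
    then obtain p where p: "is_path G r p u" "length p = Suc (f u)" "\<forall>x \<in> set p. f x \<le> f u"
      using less.hyps[of u] u by auto
    then have "v \<notin> set p"
      using u by auto
    then show ?thesis
      using p u less.prems
      by (intro exI[of _ "p @ [v]"]) (auto simp: is_path_def successively_append_iff)
  qed
qed

lemma graph_distance_eq_labelling:
  assumes f: "distance_labelling G r f" and v: "v \<in> vertices G"
  shows "graph_distance G r v = f v"
proof -
  obtain p where p: "is_path G r p v" "length p = Suc (f v)"
    using labelling_path_exists[OF f v] by blast
  obtain q where q: "is_path G r q v" "length q = Suc (graph_distance G r v)"
    using shortest_path_exists[OF p(1)] .
  show ?thesis
    using graph_distance_le[OF p(1)] labelling_le_path_length[OF f q(1)] p(2) q(2) by simp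
qed

lemma adjacent_vertices:
  assumes "finite_multigraph G" "adjacent G u v"
  shows "u \<in> vertices G" "v \<in> vertices G"
proof -
  have "set_uprod (Upair u v) \<subseteq> vertices G"
    using assms unfolding finite_multigraph_def adjacent_def by blast
  then show "u \<in> vertices G" "v \<in> vertices G"
    by auto
qed

lemma graph_distance_adjacent_le:
  assumes G: "finite_multigraph G" "connected_multigraph G" "r \<in> vertices G"
    and uv: "adjacent G u v"
  shows "graph_distance G r v \<le> Suc (graph_distance G r u)"
proof -
  have u: "u \<in> vertices G" and v: "v \<in> vertices G"
    using adjacent_vertices[OF G(1) uv] by auto
  obtain p where p: "is_path G r p u" "length p = Suc (graph_distance G r u)"
    using G(2,3) u shortest_path_exists unfolding connected_multigraph_def by metis
  show ?thesis
  proof (cases "v \<in> set p")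
    case False
    then have "is_path G r (p @ [v]) v"
      using p(1) uv v by (auto simp: is_path_def successively_append_iff)
    from graph_distance_le[OF this] p(2) show ?thesis
      by simp
  next
    \<comment> \<open>Here appending \<open>v\<close> would repeat a vertex; instead the path is cut
      at \<open>v\<close>, which only shortens it.\<close>
    case True
    then obtain xs ys where xy: "p = xs @ v # ys"
      by (meson split_list)
    have "is_path G r (xs @ [v]) v"
      using p(1) unfolding xy is_path_def
      by (auto simp: successively_append_iff hd_append)
    from graph_distance_le[OF this] p(2) show ?thesis
      by (simp add: xy)
  qed
qed

text \<open>Converse of the previous characterisation. It supplies the labelling of the seed, from
  which all labellings of networks are built.\<close>

lemma distance_labelling_graph_distance:
  assumes G: "finite_multigraph G" "connected_multigraph G" "r \<in> vertices G"
  shows "distance_labelling G r (graph_distance G r)"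
proof -
  have "is_path G r [r] r"
    using G(3) by (simp add: is_path_def)
  then have "graph_distance G r r = 0"
    using graph_distance_le by fastforce
  moreover have "\<exists>u. adjacent G u v \<and> graph_distance G r v = Suc (graph_distance G r u)"
    if v: "v \<in> vertices G" "v \<noteq> r" for v
  proof -
    obtain p where p: "is_path G r p v" "length p = Suc (graph_distance G r v)"
      using G(2,3) v shortest_path_exists unfolding connected_multigraph_def by metis
    obtain q where q: "p = q @ [v]"
      using p(1) by (metis append_butlast_last_id is_path_def)
    have "q \<noteq> []"
      using p(1) v q by (auto simp: is_path_def)
    then have path: "is_path G r q (last q)" and adj: "adjacent G (last q) v"
      using p(1) unfolding q is_path_def by (auto simp: successively_append_iff)
    \<comment> \<open>Removing the last vertex of a shortest path gives one inequality; the edge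
      from \<open>last q\<close> to \<open>v\<close> gives the other.\<close>
    have "Suc (graph_distance G r (last q)) \<le> graph_distance G r v"
      using graph_distance_le[OF path] p(2) \<open>q \<noteq> []\<close> by (cases q) (auto simp: q)
    with graph_distance_adjacent_le[OF G adj] adj show ?thesis
      by (intro exI[of _ "last q"]) auto
  qed
  ultimately show ?thesis
    using G(3) adjacent_vertices[OF G(1)] graph_distance_adjacent_le[OF G]
    unfolding distance_labelling_def by auto
qed

section \<open>Labellings under renaming and hooking\<close>

lemma vertices_rename [simp]: "vertices (rename f G) = f ` vertices G"
  by (simp add: rename_def)

lemma adjacent_rename:
  "adjacent (rename f G) a b \<longleftrightarrow> (\<exists>u v. adjacent G u v \<and> a = f u \<and> b = f v)"
proof
  assume "adjacent (rename f G) a b"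
  then obtain e where e: "e \<in># edges G" "map_uprod f e = Upair a b"
    by (auto simp: adjacent_def rename_def)
  obtain u v where uv: "e = Upair u v"
    by (cases e)
  \<comment> \<open>The ends of the renamed edge may match \<open>a\<close> and \<open>b\<close> in
    swapped order; symmetry covers that case.\<close>
  have "Upair v u = Upair u v"
    by simp
  with e uv show "\<exists>u v. adjacent G u v \<and> a = f u \<and> b = f v"
    unfolding adjacent_def by (metis Upair_inject map_uprod_simps)
next
  assume "\<exists>u v. adjacent G u v \<and> a = f u \<and> b = f v"
  then show "adjacent (rename f G) a b"
    by (force simp: adjacent_def rename_def)
qed

lemma distance_labelling_rename:
  assumes f: "distance_labelling G r f" and "inj g"
  shows "distance_labelling (rename g G) (g r) (f \<circ> inv g)"
proof -
  note [simp] = inv_f_f[OF \<open>inj g\<close>]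
  let ?R = "rename g G"
  have "g r \<in> vertices ?R" "(f \<circ> inv g) (g r) = 0"
    using f by (auto simp: distance_labelling_def)
  moreover have "a \<in> vertices ?R \<and> b \<in> vertices ?R \<and> (f \<circ> inv g) b \<le> Suc ((f \<circ> inv g) a)"
    if ab: "adjacent ?R a b" for a b
  proof -
    obtain u v where "adjacent G u v" "a = g u" "b = g v"
      using ab by (auto simp: adjacent_rename)
    then show ?thesis
      using f by (simp add: distance_labelling_def)
  qed
  moreover have "\<exists>a. adjacent ?R a b \<and> (f \<circ> inv g) b = Suc ((f \<circ> inv g) a)"
    if b: "b \<in> vertices ?R" "b \<noteq> g r" for b
  proof -
    obtain v where v: "v \<in> vertices G" "b = g v" "v \<noteq> r"
      using b by auto
    then obtain u where u: "adjacent G u v" "f v = Suc (f u)"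
      using f unfolding distance_labelling_def by blast
    then have "adjacent ?R (g u) b"
      using v by (auto simp: adjacent_rename)
    then show ?thesis
      using u v by (intro exI[of _ "g u"]) simp
  qed
  ultimately show ?thesis
    unfolding distance_labelling_def by blast
qed

lemma total_path_length_eq_labelling:
  assumes "distance_labelling G r f"
  shows "total_path_length G r = (\<Sum>v\<in>vertices G. f v)"
  unfolding total_path_length_def using graph_distance_eq_labelling[OF assms] by simp

lemma adjacent_hook_at:
  assumes "finite L"
  shows "adjacent (hook_at S h n G L) a b \<longleftrightarrow>
           adjacent G a b \<or> (\<exists>v\<in>L. \<exists>u w. adjacent S u w \<and> a = fuse h n v u \<and> b = fuse h n v w)"
proof -
  have "adjacent (hook_at S h n G L) a b \<longleftrightarrow>
          adjacent G a b \<or> (\<exists>v\<in>L. adjacent (rename (fuse h n v) S) a b)"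
    by (auto simp: adjacent_def hook_at_def set_mset_sum[OF assms])
  then show ?thesis
    by (simp add: adjacent_rename)
qed

text \<open>The tag \<open>n\<close> singles out the vertices created in the current step, and the
  constructor records their latch \<open>v\<close>. So the extension can be defined without
  mentioning the network or the latch set.\<close>

fun extend_labelling ::
    "nat \<Rightarrow> ('a vertex \<Rightarrow> nat) \<Rightarrow> ('a \<Rightarrow> nat) \<Rightarrow> 'a vertex \<Rightarrow> nat" where
  "extend_labelling n f g (Orig u) = f (Orig u)"
| "extend_labelling n f g (Copy m v u) = (if m = n then f v + g u else f (Copy m v u))"

lemma extend_labelling_old: "stage x < n \<Longrightarrow> extend_labelling n f g x = f x"
  by (cases x) auto

text \<open>The condition \<open>g h = 0\<close> lets one formula cover the fused hook as well,
  which is the old vertex \<open>v\<close>.\<close>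

lemma extend_labelling_fuse:
  assumes "stage v < n" "g h = 0"
  shows "extend_labelling n f g (fuse h n v u) = f v + g u"
  using assms by (simp add: fuse_def extend_labelling_old[OF assms(1)])

text \<open>Every edge lies in the old network or in a single copy of the seed. On the copy at
  \<open>v\<close> the labels are those of the seed shifted by the constant \<open>f v\<close>, so
  both local conditions carry over edge by edge.\<close>

lemma distance_labelling_hook_at:
  assumes f: "distance_labelling G r f" and g: "distance_labelling S h g"
    and st: "\<And>x. x \<in> vertices G \<Longrightarrow> stage x < n"
    and L: "L \<subseteq> vertices G" "finite L"
  shows "distance_labelling (hook_at S h n G L) r (extend_labelling n f g)"
proof -
  let ?H = "hook_at S h n G L" and ?e = "extend_labelling n f g"
  have old: "?e x = f x" if "x \<in> vertices G" for x
    using st[OF that] by (rule extend_labelling_old)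
  have new: "?e (fuse h n v u) = f v + g u" if "v \<in> L" for v u
    using that L st g by (intro extend_labelling_fuse) (auto simp: distance_labelling_def)
  have V: "vertices ?H = vertices G \<union> (\<Union>v\<in>L. fuse h n v ` vertices S)"
    by (simp add: hook_at_def)
  have "r \<in> vertices ?H" "?e r = 0"
    using f old by (auto simp: V distance_labelling_def)
  moreover have "a \<in> vertices ?H \<and> b \<in> vertices ?H \<and> ?e b \<le> Suc (?e a)" if "adjacent ?H a b" for a b
    using that unfolding adjacent_hook_at[OF L(2)]
  proof (elim disjE bexE exE conjE)
    assume "adjacent G a b"
    then show ?thesis
      using f old by (auto simp: V distance_labelling_def)
  next
    fix v u w assume "v \<in> L" "adjacent S u w" "a = fuse h n v u" "b = fuse h n v w"
    then show ?thesis
      using g new by (simp add: V distance_labelling_def) blast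
  qed
  moreover have "\<exists>a. adjacent ?H a b \<and> ?e b = Suc (?e a)" if b: "b \<in> vertices ?H" "b \<noteq> r" for b
  proof (cases "b \<in> vertices G")
    case True
    then obtain a where a: "adjacent G a b" "f b = Suc (f a)"
      using f b unfolding distance_labelling_def by blast
    moreover have "a \<in> vertices G"
      using f a by (auto simp: distance_labelling_def)
    ultimately show ?thesis
      using True old unfolding adjacent_hook_at[OF L(2)] by metis
  next
    case False
    then obtain v w where vw: "v \<in> L" "w \<in> vertices S" "b = fuse h n v w"
      using b by (auto simp: V)
    \<comment> \<open>The hook of a copy is its latch, an old vertex. Hence \<open>b\<close> has a
      predecessor inside its own copy.\<close>
    then have "w \<noteq> h"
      using False L by (auto simp: fuse_def)
    then obtain u where u: "adjacent S u w" "g w = Suc (g u)"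
      using g vw unfolding distance_labelling_def by blast
    then have "adjacent ?H (fuse h n v u) b"
      using vw unfolding adjacent_hook_at[OF L(2)] by blast
    then show ?thesis
      using u vw new by (intro exI[of _ "fuse h n v u"]) auto
  qed
  ultimately show ?thesis
    unfolding distance_labelling_def by blast
qed

text \<open>Each latch \<open>v\<close> contributes \<open>f v\<close> once for every non-hook
  vertex of its copy, plus the depths inside the seed. The hooks are already counted among the old
  vertices.\<close>

lemma total_path_length_hook_at:
  assumes f: "distance_labelling G r f" and g: "distance_labelling S h g"
    and fin: "finite (vertices G)" "finite (vertices S)"
    and st: "\<And>x. x \<in> vertices G \<Longrightarrow> stage x < n"
    and L: "L \<subseteq> vertices G"
  shows "total_path_length (hook_at S h n G L) r =
           total_path_length G r + (card (vertices S) - 1) * (\<Sum>v\<in>L. f v)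
             + card L * total_path_length S h"
proof -
  have finL: "finite L"
    using L fin(1) finite_subset by blast
  have h: "h \<in> vertices S" "g h = 0"
    using g by (auto simp: distance_labelling_def)
  let ?e = "extend_labelling n f g" and ?c = "\<lambda>(v, u). Copy n v u"
  let ?P = "L \<times> (vertices S - {h})"
  have V: "vertices (hook_at S h n G L) = vertices G \<union> ?c ` ?P"
    using L h(1) by (auto simp: hook_at_def fuse_def image_iff)
  have disj: "vertices G \<inter> ?c ` ?P = {}"
    using st by fastforce
  have "total_path_length (hook_at S h n G L) r = (\<Sum>x\<in>vertices G \<union> ?c ` ?P. ?e x)"
    using total_path_length_eq_labelling[OF distance_labelling_hook_at[OF f g st L finL]]
    by (simp add: V)
  also have "\<dots> = (\<Sum>x\<in>vertices G. ?e x) + (\<Sum>x\<in>?c ` ?P. ?e x)"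
    using fin finL disj by (intro sum.union_disjoint) auto
  also have "(\<Sum>x\<in>vertices G. ?e x) = total_path_length G r"
    using st by (simp add: total_path_length_eq_labelling[OF f] extend_labelling_old)
  also have "(\<Sum>x\<in>?c ` ?P. ?e x) = (\<Sum>(v, u)\<in>?P. f v + g u)"
    by (subst sum.reindex) (auto simp: inj_on_def intro!: sum.cong)
  also have "\<dots> = (\<Sum>v\<in>L. \<Sum>u\<in>vertices S - {h}. f v + g u)"
    by (simp add: sum.cartesian_product)
  also have "\<dots> = (card (vertices S) - 1) * (\<Sum>v\<in>L. f v) + card L * (\<Sum>u\<in>vertices S - {h}. g u)"
    using h fin by (simp add: sum.distrib sum_distrib_left)
  \<comment> \<open>Leaving out the hook changes nothing because its depth is 0.\<close>
  also have "(\<Sum>u\<in>vertices S - {h}. g u) = total_path_length S h"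
    using h fin by (simp add: total_path_length_eq_labelling[OF g] sum.remove)
  finally show ?thesis
    by simp
qed

section \<open>Uniformly random subsets of fixed size\<close>

text \<open>The subsets avoiding \<open>x\<close> are removed from all subsets of size
  \<open>k\<close>; Pascal's rule evaluates the difference.\<close>

lemma card_subsets_containing:
  assumes "finite A" "x \<in> A" "k \<ge> 1"
  shows "card {B. B \<subseteq> A \<and> card B = k \<and> x \<in> B} = (card A - 1) choose (k - 1)"
proof -
  let ?F = "{B. B \<subseteq> A \<and> card B = k}" and ?F' = "{B. B \<subseteq> A - {x} \<and> card B = k}"
  have "{B. B \<subseteq> A \<and> card B = k \<and> x \<in> B} = ?F - ?F'"
    by auto
  moreover have "card (?F - ?F') = card ?F - card ?F'"
    using assms by (intro card_Diff_subset) auto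
  moreover have "card A > 0"
    using assms by (auto simp: card_gt_0_iff)
  then have "card A = Suc (card A - 1)" "k = Suc (k - 1)"
    using assms by auto
  then have "card A choose k = (card A - 1 choose (k - 1)) + (card A - 1 choose k)"
    by (metis binomial_Suc_Suc)
  ultimately show ?thesis
    using assms by (simp add: n_subsets)
qed

text \<open>Double counting: every \<open>x\<close> lies in the same number of subsets of size
  \<open>k\<close>, and the proportion of subsets containing it is
  \<open>k / card A\<close>.\<close>

lemma expectation_sum_random_subset:
  fixes f :: "'a \<Rightarrow> real"
  assumes A: "finite A" and k: "1 \<le> k" "k \<le> card A"
  shows "measure_pmf.expectation (pmf_of_set {B. B \<subseteq> A \<and> card B = k}) (\<lambda>B. \<Sum>x\<in>B. f x)
           = real k / real (card A) * (\<Sum>x\<in>A. f x)"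
proof -
  let ?F = "{B. B \<subseteq> A \<and> card B = k}"
  have fin: "finite ?F"
    using A by auto
  have card: "card ?F = card A choose k"
    using A by (rule n_subsets)
  have pos: "card ?F > 0"
    using k by (simp add: card)
  \<comment> \<open>Writing \<open>B\<close> as a restriction of the fixed set \<open>A\<close>
    allows the two sums to be exchanged.\<close>
  have "(\<Sum>B\<in>?F. \<Sum>x\<in>B. f x) = (\<Sum>B\<in>?F. \<Sum>x\<in>{x \<in> A. x \<in> B}. f x)"
    by (intro sum.cong) auto
  also have "\<dots> = (\<Sum>x\<in>A. \<Sum>B\<in>{B \<in> ?F. x \<in> B}. f x)"
    using A fin by (rule sum.swap_restrict[OF _ _, symmetric, where R = "\<lambda>x B. x \<in> B"])
  also have "\<dots> = (\<Sum>x\<in>A. real ((card A - 1) choose (k - 1)) * f x)"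
    using A k card_subsets_containing[of A _ k] by (intro sum.cong) auto
  also have "\<dots> = real ((card A - 1) choose (k - 1)) * (\<Sum>x\<in>A. f x)"
    by (simp add: sum_distrib_left)
  finally have sum: "(\<Sum>B\<in>?F. \<Sum>x\<in>B. f x) = real ((card A - 1) choose (k - 1)) * (\<Sum>x\<in>A. f x)" .
  \<comment> \<open>The absorption identity for binomial coefficients.\<close>
  have "k * card ?F = card A * ((card A - 1) choose (k - 1))"
    using times_binomial_minus1_eq[of k "card A"] k by (simp add: card)
  then have "real k * real (card ?F) = real (card A) * real ((card A - 1) choose (k - 1))"
    by (metis of_nat_mult)
  then have "real ((card A - 1) choose (k - 1)) / real (card ?F) = real k / real (card A)"
    using pos k by (simp add: field_simps)
  moreover have "measure_pmf.expectation (pmf_of_set ?F) (\<lambda>B. \<Sum>x\<in>B. f x)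
                   = (\<Sum>B\<in>?F. \<Sum>x\<in>B. f x) / real (card ?F)"
    using fin pos by (intro integral_pmf_of_set) (metis card.empty less_irrefl)+
  ultimately show ?thesis
    unfolding sum by (metis times_divide_eq_left)
qed

lemma building_sequence_le_network_order:
  assumes "building_sequence t k"
  shows "k n \<le> network_order t k n"
  using assms unfolding building_sequence_def network_order_def
  by (simp add: sum.atLeast1_atMost_eq lessThan_atLeast0)

section \<open>The recursion for the expected total path length\<close>

locale multi_hooking =
  fixes S :: "'a multigraph" and h :: 'a and k :: "nat \<Rightarrow> nat"
  assumes finite_seed: "finite_multigraph S"
    and connected_seed: "connected_multigraph S"
    and hook: "h \<in> vertices S"
    and building: "building_sequence (card (vertices S)) k"
begin

abbreviation "t0 \<equiv> card (vertices S)"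
abbreviation "\<tau> \<equiv> network_order t0 k"

lemma finite_vertices_seed: "finite (vertices S)"
  using finite_seed by (simp add: finite_multigraph_def)

lemma seed_labelling: "distance_labelling S h (graph_distance S h)"
  using finite_seed connected_seed hook by (rule distance_labelling_graph_distance)

lemmas network_verticesD =
  network_vertices[OF finite_vertices_seed hook building, rule_format]

text \<open>\<open>pmf_of_set\<close> is the uniform law only on a finite nonempty set. Nonemptiness
  comes from the upper bound on \<open>k n\<close> in \<open>building_sequence\<close>.\<close>

lemma latch_sets:
  assumes "G \<in> set_pmf (network S h k n)"
  shows "finite {L. L \<subseteq> vertices G \<and> card L = k n}" "{L. L \<subseteq> vertices G \<and> card L = k n} \<noteq> {}"
proof -
  have "k n \<le> card (vertices G)"
    using network_verticesD[OF assms] building_sequence_le_network_order[OF building] by simp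
  then show "{L. L \<subseteq> vertices G \<and> card L = k n} \<noteq> {}"
    by (metis (mono_tags, lifting) empty_Collect_eq obtain_subset_with_card_n)
qed (use network_verticesD[OF assms] in auto)

text \<open>Finite support makes expectations finite sums and settles integrability.\<close>

lemma finite_set_network: "finite (set_pmf (network S h k n))"
proof (induction n)
  case (Suc n)
  have "finite (set_pmf (pmf_of_set {L. L \<subseteq> vertices G \<and> card L = k n}))"
    if "G \<in> set_pmf (network S h k n)" for G
    using latch_sets[OF that] by simp
  with Suc show ?case
    by (simp add: set_bind_pmf)
qed simp

text \<open>Mere existence suffices, as any such labelling agrees with the distance on the
  vertices.\<close>

lemma network_labelling:
  assumes "G \<in> set_pmf (network S h k n)"
  shows "\<exists>f. distance_labelling G (Orig h) f"
  using assms
proof (induction n arbitrary: G)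
  case 0
  then show ?case
    using distance_labelling_rename[OF seed_labelling, of Orig] by (auto simp: inj_def)
next
  case (Suc n)
  then obtain H L where H: "H \<in> set_pmf (network S h k n)" and L: "L \<subseteq> vertices H"
    and G: "G = hook_at S h (Suc n) H L"
    using latch_sets by auto
  obtain f where f: "distance_labelling H (Orig h) f"
    using Suc.IH[OF H] by blast
  have "finite L" "\<And>x. x \<in> vertices H \<Longrightarrow> stage x < Suc n"
    using network_verticesD[OF H] L finite_subset by (auto simp: less_Suc_eq_le)
  then show ?case
    using distance_labelling_hook_at[OF f seed_labelling _ L] unfolding G by blast
qed

text \<open>This is the conditional expectation of the next total path length given
  \<open>G\<close>; it is affine in that of \<open>G\<close>.\<close>

lemma expectation_step:
  assumes G: "G \<in> set_pmf (network S h k n)"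
  shows "measure_pmf.expectation
           (map_pmf (hook_at S h (Suc n) G) (pmf_of_set {L. L \<subseteq> vertices G \<and> card L = k n}))
           (\<lambda>H. real (total_path_length H (Orig h)))
         = real (\<tau> (Suc n)) / real (\<tau> n) * real (total_path_length G (Orig h))
             + real (k n) * real (total_path_length S h)"
proof -
  let ?T = "\<lambda>H. total_path_length H (Orig h)" and ?P = "pmf_of_set {L. L \<subseteq> vertices G \<and> card L = k n}"
  obtain f where f: "distance_labelling G (Orig h) f"
    using network_labelling[OF G] by blast
  note V = network_verticesD[OF G]
  have set: "set_pmf ?P = {L. L \<subseteq> vertices G \<and> card L = k n}"
    using latch_sets[OF G] by simp
  have fin: "finite (set_pmf ?P)"
    using latch_sets[OF G] by (simp add: set)
  have k: "1 \<le> k n" "k n \<le> card (vertices G)"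
    using V building building_sequence_le_network_order[OF building]
    by (auto simp: building_sequence_def)
  have "measure_pmf.expectation (map_pmf (hook_at S h (Suc n) G) ?P) (\<lambda>H. real (?T H))
      = measure_pmf.expectation ?P (\<lambda>L. real (t0 - 1) * (\<Sum>v\<in>L. real (f v))
          + (real (?T G) + real (k n) * real (total_path_length S h)))"
    unfolding integral_map_pmf
  proof (intro integral_cong_AE)
    \<comment> \<open>The formula for one hooking step requires \<open>L\<close> to be a set of
      \<open>k n\<close> vertices of \<open>G\<close>, so the integrands are compared only on the
      support.\<close>
    show "AE L in measure_pmf ?P. real (?T (hook_at S h (Suc n) G L)) =
            real (t0 - 1) * (\<Sum>v\<in>L. real (f v)) + (real (?T G) + real (k n) * real (total_path_length S h))"
      using total_path_length_hook_at[OF f seed_labelling _ finite_vertices_seed] V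
      by (auto simp: AE_measure_pmf_iff set less_Suc_eq_le)
  qed auto
  also have "\<dots> = real (t0 - 1) * (real (k n) / real (\<tau> n) * real (?T G))
      + (real (?T G) + real (k n) * real (total_path_length S h))"
    using expectation_sum_random_subset[of "vertices G" "k n" "\<lambda>v. real (f v)"] V k
    by (simp add: integrable_measure_pmf_finite[OF fin] total_path_length_eq_labelling[OF f])
  \<comment> \<open>The coefficient is \<open>1 + (t0 - 1) * k n / \<tau> n\<close>, whose numerator
    over \<open>\<tau> n\<close> is \<open>\<tau> (Suc n)\<close>. Positivity of
    \<open>\<tau> n\<close> follows from \<open>1 \<le> k n \<le> \<tau> n\<close>.\<close>
  also have "\<dots> = real (\<tau> (Suc n)) / real (\<tau> n) * real (?T G) + real (k n) * real (total_path_length S h)"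
    using V k by (simp add: network_order_Suc field_simps)
  finally show ?thesis .
qed

text \<open>The law of total expectation, averaging the affine one-step formula over the law of the
  current network.\<close>

lemma expectation_total_path_length_Suc:
  "measure_pmf.expectation (network S h k (Suc n)) (\<lambda>G. real (total_path_length G (Orig h)))
   = real (\<tau> (Suc n)) / real (\<tau> n)
       * measure_pmf.expectation (network S h k n) (\<lambda>G. real (total_path_length G (Orig h)))
     + real (k n) * real (total_path_length S h)"
proof -
  let ?N = "network S h k n" and ?T = "\<lambda>H. real (total_path_length H (Orig h))"
  let ?c = "real (\<tau> (Suc n)) / real (\<tau> n)" and ?d = "real (k n) * real (total_path_length S h)"
  let ?step = "\<lambda>G. map_pmf (hook_at S h (Suc n) G) (pmf_of_set {L. L \<subseteq> vertices G \<and> card L = k n})"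
  have "measure_pmf.expectation (network S h k (Suc n)) ?T
      = (\<Sum>G\<in>set_pmf ?N. pmf ?N G *\<^sub>R measure_pmf.expectation (?step G) ?T)"
    unfolding network.simps
  proof (rule pmf_expectation_bind[OF finite_set_network])
    show "finite (set_pmf (?step G))" if "G \<in> set_pmf ?N" for G
      using latch_sets[OF that] by simp
  qed simp
  also have "\<dots> = (\<Sum>G\<in>set_pmf ?N. pmf ?N G *\<^sub>R (?c * ?T G + ?d))"
    by (intro sum.cong refl arg_cong2[of _ _ _ _ scaleR] expectation_step)
  also have "\<dots> = measure_pmf.expectation ?N (\<lambda>G. ?c * ?T G + ?d)"
    by (rule integral_measure_pmf[symmetric]) (auto simp: finite_set_network)
  also have "\<dots> = ?c * measure_pmf.expectation ?N ?T + ?d"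
    by (simp add: integrable_measure_pmf_finite[OF finite_set_network])
  finally show ?thesis .
qed

lemma network_order_pos: "\<tau> n > 0"
  using hook finite_vertices_seed by (auto simp: network_order_def card_gt_0_iff)

lemma expectation_total_path_length:
  "measure_pmf.expectation (network S h k n) (\<lambda>G. real (total_path_length G (Orig h)))
   = real (total_path_length S h) * real (\<tau> n)
       * ((\<Sum>i=1..n. real (k (i - 1)) / real (\<tau> i)) + 1 / real (\<tau> 0))"
proof (induction n)
  case 0
  have inj: "inj (Orig :: 'a \<Rightarrow> 'a vertex)"
    by (simp add: inj_def)
  have "total_path_length (rename Orig S) (Orig h) = total_path_length S h"
    using total_path_length_eq_labelling[OF distance_labelling_rename[OF seed_labelling inj]]
    by (simp add: sum.reindex inj_on_subset[OF inj] inv_f_f[OF inj])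
       (simp add: total_path_length_def)
  then show ?case
    using network_order_pos[of 0] by simp
next
  case (Suc n)
  show ?case
    \<comment> \<open>The factor \<open>\<tau> (Suc n) / \<tau> n\<close> turns the leading
      \<open>\<tau> n\<close> of the induction hypothesis into \<open>\<tau> (Suc n)\<close>; the
      added term is the summand for \<open>i = Suc n\<close> times
      \<open>T0 * \<tau> (Suc n)\<close>, where \<open>T0\<close> is the total path length of the
      seed.\<close>
    unfolding expectation_total_path_length_Suc Suc.IH
    using network_order_pos[of n] network_order_pos[of "Suc n"] by (simp add: field_simps)
qed

end

theorem theorem5p1:
  fixes G0 :: "'a multigraph" and h :: 'a and k :: "nat \<Rightarrow> nat" and n :: nat
  assumes "finite_multigraph G0"
    and "connected_multigraph G0"
    and "card (vertices G0) \<ge> 2"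
    and "h \<in> vertices G0"
    and "building_sequence (card (vertices G0)) k"
  defines "\<tau> \<equiv> network_order (card (vertices G0)) k"
    and "T0 \<equiv> total_path_length G0 h"
  shows "measure_pmf.expectation (network G0 h k n) (\<lambda>G. real (total_path_length G (Orig h)))
         = real T0 * real (\<tau> n) * ((\<Sum>i=1..n. real (k (i - 1)) / real (\<tau> i)) + 1 / real (\<tau> 0))"
proof -
  interpret multi_hooking G0 h k
    using assms by unfold_locales
  show ?thesis
    unfolding \<tau>_def T0_def by (rule expectation_total_path_length)
qed

end
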